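(* Let $(b_k)_{k\ge1}$, $(c_k)_{k\ge1}$ be sequences of complex numbers, $|z|,|t|,|q|<1$, and $$\prod_{k=1}^\infty\frac{1}{(1-zq^k)^{b_k}}\prod_{k=1}^\infty\frac{1}{(1-tq^k)^{c_k}}=\sum_{n\ge0}P(n)q^n,$$ so that $P(n)=\sum_{(\pi,\mu)}\prod_i\frac{(b_i)_{r_i}}{r_i!}z^{r_i}\prod_j\frac{(c_j)_{s_j}}{s_j!}t^{s_j}$, the sum over pairs of partitions $\pi=\sum_ir_iu_i$, $\mu=\sum_js_jv_j$ with $|\pi|+|\mu|=n$. Let $F^z_k(n)$ be the same sum restricted to pairs with $r_k>0$ and with each term multiplied by $r_k$, and $F^t_k(n)$ the same sum restricted to pairs with $s_k>0$ and each term multiplied by $s_k$. Then for all $n\ge1$: (a) for each $i=1,\dots,n$, $\displaystyle F^z_i(n)+F^t_i(n)=\sum_{j=1}^n a_i(j)P(n-j)$, where $a_i(j)=b_iz^r+c_it^r$ if $j=ri$ for some integer $r\ge1$, and $a_i(j)=0$ otherwise; (b) equivalently with a $2n\times n$ matrix: for each $s=1,\dots,n$, $\displaystyle F^z_s(n)=\sum_{j=1}^n a_{2s-1}(j)P(n-j)$ and $\displaystyle F^t_s(n)=\sum_{j=1}^n a_{2s}(j)P(n-j)$, where $a_{2s-1}(j)=b_sz^r$ and $a_{2s}(j)=c_st^r$ if $j=rs$ for some integer $r\ge1$, and both are $0$ otherwise.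
   Context: Partitions are written $\pi=\sum_ir_iu_i$ meaning part $i$ occurs $r_i$ times; $|\pi|=\sum_i ir_i$. $(a)_0=1$, $(a)_r=a(a+1)\cdots(a+r-1)$. *)

theory Defs
  imports
    "HOL-Analysis.Analysis"
    "HOL-Computational_Algebra.Formal_Power_Series"
    "HOL-Library.Multiset"
begin

text \<open>
  A partition is the finite multiset of its parts, all of them positive. For
  \<open>\<pi> = \<Sum>\<^sub>i r\<^sub>i u\<^sub>i\<close> the multiplicity \<open>r\<^sub>i\<close> is \<open>count \<pi> i\<close> and \<open>|\<pi>|\<close> is \<open>sum_mset \<pi>\<close>.
\<close>

definition partition_pairs :: "nat \<Rightarrow> (nat multiset \<times> nat multiset) set" where
  "partition_pairs n =
     {(\<pi>, \<mu>). 0 \<notin># \<pi> \<and> 0 \<notin># \<mu> \<and> sum_mset \<pi> + sum_mset \<mu> = n}"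

text \<open>
  The sums below range over subsets of \<open>partition_pairs n\<close>, so finiteness is needed for them to
  have their intended meaning.
\<close>

lemma finite_partition_pairs: "finite (partition_pairs n)"
proof -
  let ?M = "\<Union>k\<le>n. multisets_of_size {..n} k"
  have *: "\<pi> \<in> ?M" if "0 \<notin># \<pi>" "sum_mset \<pi> \<le> n" for \<pi> :: "nat multiset"
  proof -
    have "size \<pi> \<le> sum_mset \<pi>" using that(1) by (induction \<pi>) auto
    moreover have "x \<le> n" if "x \<in># \<pi>" for x
      using that \<open>sum_mset \<pi> \<le> n\<close> by (auto dest!: multi_member_split)
    ultimately show ?thesis using that by (auto simp: multisets_of_size_def)
  qed
  have "partition_pairs n \<subseteq> ?M \<times> ?M"
  proof
    fix p assume "p \<in> partition_pairs n"
    then show "p \<in> ?M \<times> ?M"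
      using *[of "fst p"] *[of "snd p"] unfolding partition_pairs_def mem_Times_iff by auto
  qed
  moreover have "finite ?M" by auto
  ultimately show ?thesis by (meson finite_SigmaI finite_subset)
qed

text \<open>
  The product over all \<open>i \<ge> 1\<close> is taken over the parts of \<open>\<pi>\<close> only; any other index has \<open>r\<^sub>i = 0\<close>
  and would contribute the factor \<open>(b\<^sub>i)\<^sub>0 / 0! * z\<^sup>0 = 1\<close>.
\<close>

definition partition_weight :: "(nat \<Rightarrow> complex) \<Rightarrow> complex \<Rightarrow> nat multiset \<Rightarrow> complex" where
  "partition_weight b z \<pi> =
     (\<Prod>i\<in>set_mset \<pi>. pochhammer (b i) (count \<pi> i) / fact (count \<pi> i) * z ^ count \<pi> i)"

definition F_z :: "(nat \<Rightarrow> complex) \<Rightarrow> (nat \<Rightarrow> complex) \<Rightarrow> complex \<Rightarrow> complex \<Rightarrow> nat \<Rightarrow> nat \<Rightarrow> complex"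
  where
  "F_z b c z t k n =
     (\<Sum>(\<pi>, \<mu>) \<in> {(\<pi>, \<mu>) \<in> partition_pairs n. count \<pi> k > 0}.
        of_nat (count \<pi> k) * (partition_weight b z \<pi> * partition_weight c t \<mu>))"

definition F_t :: "(nat \<Rightarrow> complex) \<Rightarrow> (nat \<Rightarrow> complex) \<Rightarrow> complex \<Rightarrow> complex \<Rightarrow> nat \<Rightarrow> nat \<Rightarrow> complex"
  where
  "F_t b c z t k n =
     (\<Sum>(\<pi>, \<mu>) \<in> {(\<pi>, \<mu>) \<in> partition_pairs n. count \<mu> k > 0}.
        of_nat (count \<mu> k) * (partition_weight b z \<pi> * partition_weight c t \<mu>))"

text \<open>
  \<open>1 / (1 - z q\<^sup>k)\<^sup>b\<close> as a formal power series in \<open>q\<close>, for \<open>k \<ge> 1\<close>: \<open>fps_binomial b\<close> is the series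
  of \<open>(1 + X)\<^sup>b\<close>, into which \<open>- z q\<^sup>k\<close> (which has no constant term) is substituted.
\<close>

definition fps_factor :: "complex \<Rightarrow> complex \<Rightarrow> nat \<Rightarrow> complex fps" where
  "fps_factor b z k = inverse (fps_binomial b oo (- (fps_const z * fps_X ^ k)))"

text \<open>
  The same factor as a complex number; for \<open>|z|, |q| < 1\<close> the base has positive real part and
  \<open>powr\<close> is the principal branch.
\<close>

definition complex_factor :: "complex \<Rightarrow> complex \<Rightarrow> nat \<Rightarrow> complex \<Rightarrow> complex" where
  "complex_factor b z k q = 1 / (1 - z * q ^ k) powr b"

text \<open>In the next two definitions \<open>j = r i\<close> with \<open>r = j div i\<close>; row indices start at 1.\<close>

definition row_coeff ::
  "(nat \<Rightarrow> complex) \<Rightarrow> (nat \<Rightarrow> complex) \<Rightarrow> complex \<Rightarrow> complex \<Rightarrow> nat \<Rightarrow> nat \<Rightarrow> complex" where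
  "row_coeff b c z t i j =
     (if \<exists>r\<ge>1. j = r * i then b i * z ^ (j div i) + c i * t ^ (j div i) else 0)"

text \<open>
  The \<open>2n \<times> n\<close> matrix: the odd row \<open>m = 2s - 1\<close> carries \<open>b\<^sub>s\<close> and \<open>z\<close>, the even row \<open>m = 2s\<close>
  carries \<open>c\<^sub>s\<close> and \<open>t\<close>; in both cases \<open>s = (m + 1) div 2\<close>.
\<close>

definition split_row_coeff ::
  "(nat \<Rightarrow> complex) \<Rightarrow> (nat \<Rightarrow> complex) \<Rightarrow> complex \<Rightarrow> complex \<Rightarrow> nat \<Rightarrow> nat \<Rightarrow> complex" where
  "split_row_coeff b c z t m j =
     (let s = (m + 1) div 2 in
      if \<exists>r\<ge>1. j = r * s
      then (if odd m then b s * z ^ (j div s) else c s * t ^ (j div s))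
      else 0)"

end

theory Submission
  imports
    Defs
    "HOL-Computational_Algebra.Formal_Laurent_Series"
begin

text \<open>
  Writing \<open>w\<^sub>k(r) = (b\<^sub>k)\<^sub>r z\<^sup>r / r!\<close>, the \<open>k\<close>-th factor is \<open>\<Sum>\<^sub>r w\<^sub>k(r) q\<^bsup>kr\<^esup>\<close>, and
  multiplying out the factors gives the sum over partitions. Weighting a partition by its
  multiplicity \<open>r\<^sub>k\<close> replaces \<open>w\<^sub>k(r)\<close> by \<open>r w\<^sub>k(r) = \<Sum>\<^sub>i b\<^sub>k z\<^sup>i w\<^sub>k(r - i)\<close> with \<open>1 \<le> i \<le> r\<close>, which multiplies the
  generating function by \<open>\<Sum>\<^sub>i b\<^sub>k z\<^sup>i q\<^bsup>ki\<^esup>\<close>; comparing coefficients gives the identities for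
  \<open>F\<^sub>k\<close>. For the analytic product, the series with every weight replaced by its absolute value is
  bounded by \<open>exp (\<Sum>\<^sub>k |b\<^sub>k z q\<^sup>k| / (1 - |z|))\<close>, so it dominates the finite
  products and Tannery's theorem lets the number of factors tend to infinity.
\<close>

unbundle no vec_syntax

section \<open>Partitions with parts in a given set, and the expansion of products over
  parts\<close>

text \<open>The set of allowed parts is a parameter so that finite products of factors can be
  expanded by induction on it.\<close>

definition partitions_in :: "nat set \<Rightarrow> nat \<Rightarrow> nat multiset set" where
  "partitions_in S n = {\<pi>. set_mset \<pi> \<subseteq> S \<and> sum_mset \<pi> = n}"

text \<open>This is the coefficient of x^r in (1 - z x)^(-b). The field is left general because the
  majorant uses the same weights over the reals.\<close>

definition binomial_weight :: "'a::field_char_0 \<Rightarrow> 'a \<Rightarrow> nat \<Rightarrow> 'a" where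
  "binomial_weight b z r = pochhammer b r / fact r * z ^ r"

lemma finite_partitions_in:
  assumes "0 \<notin> S"
  shows "finite (partitions_in S n)"
proof (rule finite_subset)
  show "partitions_in S n \<subseteq> fst ` partition_pairs n"
  proof
    fix \<pi> assume "\<pi> \<in> partitions_in S n"
    then have "(\<pi>, {#}) \<in> partition_pairs n"
      using assms by (auto simp: partitions_in_def partition_pairs_def)
    then show "\<pi> \<in> fst ` partition_pairs n" by force
  qed
qed (simp add: finite_partition_pairs)

lemma member_le_sum_mset:
  fixes x :: nat
  assumes "x \<in># \<pi>"
  shows "x \<le> sum_mset \<pi>"
  using assms by (auto dest!: multi_member_split)

text \<open>No part exceeds the size of its partition, so a coefficient of index n depends on the
  factors up to n only.\<close>

lemma partitions_in_positive:
  assumes "n \<le> N"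
  shows "partitions_in {0<..N} n = partitions_in {0<..} n"
  using assms member_le_sum_mset
  by (fastforce simp: partitions_in_def)

lemma sum_mset_remove_part:
  fixes \<pi> :: "nat multiset"
  shows "sum_mset (filter_mset (\<lambda>x. x \<noteq> k) \<pi>) + k * count \<pi> k = sum_mset \<pi>"
  by (induction \<pi>) auto

text \<open>By induction on \<open>S\<close>: choosing the term q^(k r) from the factor for a new
  \<open>k\<close> means adding r copies of \<open>k\<close> to a partition with parts in
  \<open>S\<close>. The family \<open>g\<close> is arbitrary so that it can stand for the weights,
  for the weights times a multiplicity, or for their absolute values.\<close>

lemma prod_compose_power_nth:
  fixes g :: "nat \<Rightarrow> nat \<Rightarrow> 'a::comm_ring_1"
  assumes "finite S" "0 \<notin> S"
  shows "(\<Prod>k\<in>S. Abs_fps (g k) oo fps_X ^ k) $ n =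
    (\<Sum>\<pi>\<in>partitions_in S n. \<Prod>k\<in>S. g k (count \<pi> k))"
  using assms
proof (induction S arbitrary: n rule: finite_induct)
  case empty
  have "partitions_in {} n = (if n = 0 then {{#}} else {})"
    by (auto simp: partitions_in_def)
  then show ?case by simp
next
  case (insert k S)
  have k: "k > 0" and S: "0 \<notin> S" using insert.prems by auto
  let ?w = "\<lambda>\<pi>. \<Prod>i\<in>S. g i (count \<pi> i)"
  let ?D = "{i\<in>{0..n}. k dvd i}"
  have "(\<Prod>i\<in>insert k S. Abs_fps (g i) oo fps_X ^ i) $ n =
    (\<Sum>i\<in>{0..n}. (if k dvd i then g k (i div k) else 0) * (\<Sum>\<pi>\<in>partitions_in S (n - i). ?w \<pi>))"
    using insert.hyps insert.IH[OF S]
    by (simp add: fps_mult_nth fps_nth_compose_X_power) (intro sum.cong, auto)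
  \<comment> \<open>Only multiples of \<open>k\<close> are kept, so \<open>i\<close> can be
    recovered from \<open>i div k\<close> and the reindexing below is a bijection.\<close>
  also have "\<dots> = (\<Sum>i\<in>?D. g k (i div k) * (\<Sum>\<pi>\<in>partitions_in S (n - i). ?w \<pi>))"
    by (intro sum.mono_neutral_cong_right) auto
  also have "\<dots> = (\<Sum>(i, \<pi>)\<in>(SIGMA i:?D. partitions_in S (n - i)). g k (i div k) * ?w \<pi>)"
    by (simp add: sum_distrib_left sum.Sigma finite_partitions_in[OF S])
  also have "\<dots> = (\<Sum>\<pi>\<in>partitions_in (insert k S) n. \<Prod>i\<in>insert k S. g i (count \<pi> i))"
  proof (rule sum.reindex_bij_witness
      [where j = "\<lambda>(i, \<pi>). replicate_mset (i div k) k + \<pi>"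
         and i = "\<lambda>\<pi>. (k * count \<pi> k, filter_mset (\<lambda>x. x \<noteq> k) \<pi>)"], goal_cases)
    case (1 p)
    then obtain i \<pi> where p: "p = (i, \<pi>)" "i \<le> n" "k dvd i" "\<pi> \<in> partitions_in S (n - i)"
      by auto
    have *: "k \<notin># \<pi>" using p insert.hyps by (auto simp: partitions_in_def)
    then show ?case using p by (auto simp: not_in_iff multiset_eq_iff)
  next
    case (2 p)
    then show ?case
      by (auto simp: partitions_in_def sum_mset_replicate_mset split: if_splits)
  next
    case (3 \<pi>)
    show ?case using k
      by (auto simp: multiset_eq_iff)
  next
    case (4 \<pi>)
    then show ?case
      using sum_mset_remove_part[of k \<pi>]
      by (auto simp: partitions_in_def)
  next
    case (5 p)
    then obtain i \<pi> where p: "p = (i, \<pi>)" "\<pi> \<in> partitions_in S (n - i)"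
      by auto
    then have "k \<notin># \<pi>" using insert.hyps by (auto simp: partitions_in_def)
    moreover have "(\<Prod>x\<in>S. g x (count (replicate_mset (i div k) k + \<pi>) x)) = ?w \<pi>"
      using insert.hyps by (intro prod.cong) auto
    ultimately show ?case using p insert.hyps by (simp add: not_in_iff)
  qed
  finally show ?case .
qed

section \<open>The factors as binomial series and their formal infinite product\<close>

text \<open>The inverse of (1 + X)^b is (1 + X)^(-b), and substituting - z X^k splits into scaling X
  by - z and then replacing X by X^k. The scaling alone gives the coefficients, as the signs cancel
  in (-b choose r) (-z)^r.\<close>

lemma fps_factor_eq:
  assumes "k > 0"
  shows "fps_factor b z k = Abs_fps (binomial_weight b z) oo fps_X ^ k"
proof -
  have "fps_binomial b * fps_binomial (- b) = 1"
    by (simp flip: fps_binomial_add_mult)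
  then have inv: "inverse (fps_binomial b) = fps_binomial (- b)"
    by (rule fps_inverse_unique)
  have "fps_factor b z k = fps_binomial (- b) oo - (fps_const z * fps_X ^ k)"
    using assms unfolding fps_factor_def inv[symmetric]
    by (intro fps_inverse_compose[symmetric]) (auto simp: )
  also have "- (fps_const z * fps_X ^ k) = (fps_const (- z) * fps_X) oo fps_X ^ k"
    using assms by (simp add: fps_compose_mult_distrib fps_compose_uminus fps_const_neg[symmetric] del: fps_const_neg)
  also have "fps_binomial (- b) oo \<dots> = (fps_binomial (- b) oo (fps_const (- z) * fps_X)) oo fps_X ^ k"
    using assms by (intro fps_compose_assoc) auto
  also have "fps_binomial (- b) oo (fps_const (- z) * fps_X) = Abs_fps (binomial_weight b z)"
    unfolding fps_compose_linear
    by (auto simp: fps_eq_iff binomial_weight_def gbinomial_pochhammer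
        power_mult_distrib[symmetric] mult_ac)
  finally show ?thesis .
qed

text \<open>Coefficient form of x f'(x) = (b z x / (1 - z x)) f(x) for f(x) = (1 - z x)^(-b). The
  induction uses the recurrence (r + 1) w(r + 1) = (b + r) z w(r).\<close>

lemma binomial_weight_mult_index:
  "of_nat r * binomial_weight b z r =
     (\<Sum>i\<le>r. (if i = 0 then 0 else b * z ^ i) * binomial_weight b z (r - i))"
proof (induction r)
  case (Suc r)
  let ?a = "\<lambda>i. if i = 0 then 0 else b * z ^ i"
  have step: "of_nat (Suc r) * binomial_weight b z (Suc r) = (b + of_nat r) * z * binomial_weight b z r"
    by (simp add: binomial_weight_def pochhammer_Suc del: of_nat_Suc)
  \<comment> \<open>The sequence is geometric with ratio z except at its start: \<open>?a 0\<close>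
    is 0 instead of b, which is the source of the extra summand.\<close>
  have eq: "?a (Suc i) = z * (?a i + (if i = 0 then b else 0))" for i
    by simp
  have "(\<Sum>i\<le>Suc r. ?a i * binomial_weight b z (Suc r - i)) =
    (\<Sum>i\<le>r. ?a (Suc i) * binomial_weight b z (r - i))"
    unfolding sum.atMost_Suc_shift by simp
  also have "\<dots> = (\<Sum>i\<le>r. z * (?a i * binomial_weight b z (r - i)) + (if i = 0 then z * b * binomial_weight b z (r - i) else 0))"
    by (intro sum.cong refl) (simp add: eq algebra_simps)
  also have "\<dots> = z * (of_nat r * binomial_weight b z r) + z * b * binomial_weight b z r"
    by (simp add: sum.distrib sum_distrib_left[symmetric] Suc.IH)
  also have "\<dots> = of_nat (Suc r) * binomial_weight b z (Suc r)"
    unfolding step by (simp add: algebra_simps)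
  finally show ?case ..
qed simp

lemma partition_weight_eq:
  assumes "set_mset \<pi> \<subseteq> S" "finite S"
  shows "partition_weight b z \<pi> = (\<Prod>k\<in>S. binomial_weight (b k) z (count \<pi> k))"
  unfolding partition_weight_def binomial_weight_def
  using assms by (intro prod.mono_neutral_left) (auto simp: not_in_iff)

text \<open>The candidate for the infinite product, given by its coefficients so that convergence
  can be checked coefficient by coefficient.\<close>

definition partition_series :: "(nat \<Rightarrow> complex) \<Rightarrow> complex \<Rightarrow> complex fps" where
  "partition_series b z = Abs_fps (\<lambda>n. \<Sum>\<pi>\<in>partitions_in {0<..} n. partition_weight b z \<pi>)"

lemma prod_fps_factor_nth_partitions:
  "(\<Prod>k\<in>{0<..N}. fps_factor (b k) z k) $ n =
    (\<Sum>\<pi>\<in>partitions_in {0<..N} n. partition_weight b z \<pi>)"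
proof -
  have "(\<Prod>k\<in>{0<..N}. fps_factor (b k) z k) $ n
      = (\<Prod>k\<in>{0<..N}. Abs_fps (binomial_weight (b k) z) oo fps_X ^ k) $ n"
    by (simp add: fps_factor_eq)
  also have "\<dots> = (\<Sum>\<pi>\<in>partitions_in {0<..N} n. \<Prod>k\<in>{0<..N}. binomial_weight (b k) z (count \<pi> k))"
    by (rule prod_compose_power_nth) auto
  also have "\<dots> = (\<Sum>\<pi>\<in>partitions_in {0<..N} n. partition_weight b z \<pi>)"
    by (intro sum.cong partition_weight_eq[symmetric]) (auto simp: partitions_in_def)
  finally show ?thesis .
qed

text \<open>Factors with k > n are 1 + O(q^k), so the coefficient of index n stops changing from N =
  n on.\<close>

lemma prod_fps_factor_nth:
  assumes "n \<le> N"
  shows "(\<Prod>k\<in>{0<..N}. fps_factor (b k) z k) $ n = partition_series b z $ n"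
  using assms
  by (simp add: prod_fps_factor_nth_partitions partitions_in_positive partition_series_def)

text \<open>Bridges infinite products, whose index starts at 0, and factors, whose index starts at
  1.\<close>

lemma prod_atMost_Suc_shift:
  fixes f :: "nat \<Rightarrow> 'a::comm_monoid_mult"
  shows "(\<Prod>k\<le>N. f (Suc k)) = (\<Prod>k\<in>{0<..Suc N}. f k)"
  by (rule prod.reindex_bij_witness[where i = "\<lambda>k. k - 1" and j = Suc]) auto

lemma fps_factor_has_prod:
  "(\<lambda>k. fps_factor (b (Suc k)) z (Suc k)) has_prod partition_series b z"
proof -
  have "(\<lambda>N. \<Prod>k\<le>N. fps_factor (b (Suc k)) z (Suc k)) \<longlonglongrightarrow> partition_series b z"
  proof (rule tendsto_fpsI)
    fix n
    show "\<forall>\<^sub>F N in sequentially. (\<Prod>k\<le>N. fps_factor (b (Suc k)) z (Suc k)) $ n = partition_series b z $ n"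
      using eventually_ge_at_top[of n]
      by eventually_elim
         (simp add: prod_atMost_Suc_shift[where f = "\<lambda>k. fps_factor (b k) z k"] prod_fps_factor_nth)
  qed
  \<comment> \<open>\<open>has_prod\<close> asks for a nonzero limit here; the empty partition makes
    the constant coefficient 1.\<close>
  moreover have "partitions_in {0<..} 0 = {{#}}"
    by (auto simp: partitions_in_def subset_iff) (metis less_numeral_extra(3) multiset_nonemptyE)
  then have "partition_series b z $ 0 = 1"
    by (simp add: partition_series_def partition_weight_def)
  then have "partition_series b z \<noteq> 0" by auto
  ultimately show ?thesis
    by (simp add: has_prod_def raw_has_prod_def)
qed

section \<open>Sums over pairs of partitions and sums weighted by a multiplicity\<close>

text \<open>Sorting the pairs by the size i of the first partition yields the Cauchy
  product.\<close>

lemma sum_partition_pairs: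
  fixes f g :: "nat multiset \<Rightarrow> 'a::comm_semiring_1"
  shows "(\<Sum>(\<pi>, \<mu>)\<in>partition_pairs n. f \<pi> * g \<mu>) =
    (Abs_fps (\<lambda>m. \<Sum>\<pi>\<in>partitions_in {0<..} m. f \<pi>) *
     Abs_fps (\<lambda>m. \<Sum>\<mu>\<in>partitions_in {0<..} m. g \<mu>)) $ n"
proof -
  have "partition_pairs n =
    (\<Union>i\<in>{0..n}. partitions_in {0<..} i \<times> partitions_in {0<..} (n - i))"
    by (auto simp: partition_pairs_def partitions_in_def subset_iff)
       (metis gr0I)+
  then have "(\<Sum>(\<pi>, \<mu>)\<in>partition_pairs n. f \<pi> * g \<mu>) =
    (\<Sum>i=0..n. \<Sum>(\<pi>, \<mu>)\<in>partitions_in {0<..} i \<times> partitions_in {0<..} (n - i). f \<pi> * g \<mu>)"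
    by (simp only:, intro sum.UNION_disjoint)
       (auto simp: finite_partitions_in, auto simp: partitions_in_def)
  then show ?thesis
    by (simp add: fps_mult_nth sum_product sum.cartesian_product)
qed

text \<open>The multiplicity affects only the factor for \<open>k\<close>, and by
  \<open>binomial_weight_mult_index\<close> it multiplies that factor by the series on the
  right.\<close>

lemma sum_count_partition_weight:
  assumes "k > 0"
  shows "Abs_fps (\<lambda>n. \<Sum>\<pi>\<in>partitions_in {0<..} n. of_nat (count \<pi> k) * partition_weight b z \<pi>) =
    (Abs_fps (\<lambda>r. if r = 0 then 0 else b k * z ^ r) oo fps_X ^ k) * partition_series b z"
    (is "?L = ?A * _")
proof (rule fps_ext)
  fix n
  \<comment> \<open>The bound must reach n to admit all partitions of n, and \<open>k\<close> so
    that the factor to be changed is present even when k > n.\<close>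
  define S where "S = {0<..max n k}"
  have S: "finite S" "0 \<notin> S" "k \<in> S" using assms by (auto simp: S_def)
  let ?w = "\<lambda>i. binomial_weight (b i) z"
  let ?g = "\<lambda>i r. (if i = k then of_nat r else 1) * ?w i r"
  have *: "Abs_fps (?g k) oo fps_X ^ k = ?A * (Abs_fps (?w k) oo fps_X ^ k)"
  proof -
    have "Abs_fps (?g k) = Abs_fps (\<lambda>r. if r = 0 then 0 else b k * z ^ r) * Abs_fps (?w k)"
      by (simp add: fps_eq_iff fps_mult_nth binomial_weight_mult_index atMost_atLeast0)
    then show ?thesis using assms by (simp add: fps_compose_mult_distrib)
  qed
  have "?L $ n = (\<Sum>\<pi>\<in>partitions_in S n. of_nat (count \<pi> k) * partition_weight b z \<pi>)"
    by (simp add: S_def partitions_in_positive)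
  also have "\<dots> = (\<Sum>\<pi>\<in>partitions_in S n. \<Prod>i\<in>S. ?g i (count \<pi> i))"
  proof (intro sum.cong refl)
    fix \<pi> assume "\<pi> \<in> partitions_in S n"
    then have "partition_weight b z \<pi> = (\<Prod>i\<in>S. ?w i (count \<pi> i))"
      using S by (intro partition_weight_eq) (auto simp: partitions_in_def)
    then show "of_nat (count \<pi> k) * partition_weight b z \<pi> = (\<Prod>i\<in>S. ?g i (count \<pi> i))"
      using S by (simp add: prod.distrib)
  qed
  also have "\<dots> = (\<Prod>i\<in>S. Abs_fps (?g i) oo fps_X ^ i) $ n"
    using S by (intro prod_compose_power_nth[symmetric])
  also have "(\<Prod>i\<in>S. Abs_fps (?g i) oo fps_X ^ i) =
      (Abs_fps (?g k) oo fps_X ^ k) * (\<Prod>i\<in>S - {k}. Abs_fps (?g i) oo fps_X ^ i)"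
    using S by (intro prod.remove)
  also have "(\<Prod>i\<in>S - {k}. Abs_fps (?g i) oo fps_X ^ i) = (\<Prod>i\<in>S - {k}. Abs_fps (?w i) oo fps_X ^ i)"
    by (intro prod.cong) auto
  also have "(Abs_fps (?g k) oo fps_X ^ k) * \<dots> = ?A * (\<Prod>i\<in>S. Abs_fps (?w i) oo fps_X ^ i)"
    unfolding * by (simp add: prod.remove[OF S(1,3)] mult_ac)
  also have "(\<Prod>i\<in>S. Abs_fps (?w i) oo fps_X ^ i) = (\<Prod>i\<in>S. fps_factor (b i) z i)"
    by (intro prod.cong) (auto simp: S_def fps_factor_eq)
  also have "(?A * \<dots>) $ n = (?A * partition_series b z) $ n"
    unfolding fps_mult_nth S_def by (intro sum.cong) (auto simp: prod_fps_factor_nth)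
  finally show "?L $ n = (?A * partition_series b z) $ n" .
qed

lemma sum_partition_weight_pairs:
  "(\<Sum>(\<pi>, \<mu>)\<in>partition_pairs n. partition_weight b z \<pi> * partition_weight c t \<mu>) =
    (partition_series b z * partition_series c t) $ n"
  unfolding partition_series_def by (rule sum_partition_pairs)

lemma F_z_eq:
  assumes "k > 0"
  shows "F_z b c z t k n = ((Abs_fps (\<lambda>r. if r = 0 then 0 else b k * z ^ r) oo fps_X ^ k) *
    (partition_series b z * partition_series c t)) $ n"
proof -
  have "F_z b c z t k n = (\<Sum>(\<pi>, \<mu>)\<in>partition_pairs n.
      (of_nat (count \<pi> k) * partition_weight b z \<pi>) * partition_weight c t \<mu>)"
    unfolding F_z_def
    by (intro sum.mono_neutral_cong_left) (auto simp: finite_partition_pairs mult_ac)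
  then show ?thesis
    unfolding sum_partition_pairs sum_count_partition_weight[OF assms] partition_series_def[symmetric]
    by (simp add: mult_ac)
qed

lemma F_t_eq_F_z: "F_t b c z t k n = F_z c b t z k n"
  unfolding F_t_def F_z_def
  by (rule sum.reindex_bij_witness[where i = prod.swap and j = prod.swap])
     (auto simp: partition_pairs_def mult_ac)

lemma compose_power_mult_nth:
  assumes "k > 0"
  shows "((Abs_fps (\<lambda>r. if r = 0 then 0 else a r) oo fps_X ^ k) * f) $ n =
    (\<Sum>j=1..n. (if \<exists>r\<ge>1. j = r * k then a (j div k) else 0) * f $ (n - j))"
proof -
  have "((Abs_fps (\<lambda>r. if r = 0 then 0 else a r) oo fps_X ^ k) * f) $ n =
    (\<Sum>j=0..n. (if \<exists>r\<ge>1. j = r * k then a (j div k) else 0) * f $ (n - j))"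
    unfolding fps_mult_nth fps_nth_compose_X_power
  proof (intro sum.cong refl arg_cong2[where f = "(*)"])
    fix j
    show "(if k dvd j then Abs_fps (\<lambda>r. if r = 0 then 0 else a r) $ (j div k) else 0) =
      (if \<exists>r\<ge>1. j = r * k then a (j div k) else 0)"
    proof (cases "\<exists>r\<ge>1. j = r * k")
      case True
      then show ?thesis using assms by auto
    next
      case False
      then have "j = 0 \<or> \<not> k dvd j"
        by (metis dvd_div_mult_self le_numeral_extra(4) less_one mult_eq_0_iff not_le)
      then show ?thesis using False by auto
    qed
  qed
  \<comment> \<open>The term for j = 0 vanishes because r \<ge> 1 and k > 0 exclude 0 = r k.\<close>
  also have "\<dots> = (\<Sum>j=1..n. (if \<exists>r\<ge>1. j = r * k then a (j div k) else 0) * f $ (n - j))"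
    using assms by (intro sum.mono_neutral_right) auto
  finally show ?thesis .
qed

lemma F_z_eq_sum:
  assumes "k > 0"
  shows "F_z b c z t k n = (\<Sum>j=1..n. (if \<exists>r\<ge>1. j = r * k then b k * z ^ (j div k) else 0) *
    (partition_series b z * partition_series c t) $ (n - j))"
  unfolding F_z_eq[OF assms] by (rule compose_power_mult_nth[OF assms])

section \<open>Evaluation and radius of convergence of the factors and their products\<close>

text \<open>The substitution only inserts zeros between the terms, so the sum survives without any
  absolute convergence.\<close>

lemma sums_compose_power:
  fixes a :: "nat \<Rightarrow> 'a::{real_normed_algebra_1, comm_ring_1}"
  assumes "k > 0" "(\<lambda>r. a r * (q ^ k) ^ r) sums s"
  shows "(\<lambda>n. (Abs_fps a oo fps_X ^ k) $ n * q ^ n) sums s"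
proof -
  let ?f = "\<lambda>n. (Abs_fps a oo fps_X ^ k) $ n * q ^ n"
  have "(\<lambda>r. ?f (k * r)) sums s"
    using assms by (simp add: fps_nth_compose_X_power power_mult)
  moreover have "strict_mono (\<lambda>r. k * r)"
    using assms by (intro strict_monoI) auto
  moreover have "?f n = 0" if "n \<notin> range (\<lambda>r. k * r)" for n
    using that by (auto simp: fps_nth_compose_X_power elim!: dvdE)
  ultimately show ?thesis
    using sums_mono_reindex[of "\<lambda>r. k * r" ?f s] by blast
qed

lemma fps_conv_radius_compose_power:
  fixes a :: "nat \<Rightarrow> 'a::{real_normed_field, banach}"
  assumes "k > 0" "\<And>x. norm x < 1 \<Longrightarrow> summable (\<lambda>r. a r * x ^ r)"
  shows "fps_conv_radius (Abs_fps a oo fps_X ^ k) \<ge> 1"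
  unfolding fps_conv_radius_def
proof (rule conv_radius_geI_ex')
  fix r :: real
  assume "0 < r" "ereal r < 1"
  then have "norm (of_real r ^ k :: 'a) < 1"
    using assms(1) by (simp add: norm_power power_less_one_iff)
  then obtain s where "(\<lambda>j. a j * (of_real r ^ k) ^ j) sums s"
    using assms(2) by (auto simp: summable_def)
  then show "summable (\<lambda>n. (Abs_fps a oo fps_X ^ k) $ n * of_real r ^ n)"
    using sums_compose_power[OF assms(1)] by (auto simp: summable_def)
qed

lemma eval_fps_compose_power:
  fixes a :: "nat \<Rightarrow> 'a::{real_normed_field, banach}"
  assumes "k > 0" "(\<lambda>r. a r * (q ^ k) ^ r) sums s"
  shows "eval_fps (Abs_fps a oo fps_X ^ k) q = s"
  using sums_unique[OF sums_compose_power[OF assms]] by (simp add: eval_fps_def)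

text \<open>Both claims come from one induction: evaluating a product in the induction step needs
  the radius bound for the remaining factors.\<close>

lemma
  fixes f :: "'b \<Rightarrow> 'a::{real_normed_field, banach} fps" and R :: ereal
  assumes "\<And>k. k \<in> S \<Longrightarrow> fps_conv_radius (f k) \<ge> R"
  shows fps_conv_radius_prod: "fps_conv_radius (\<Prod>k\<in>S. f k) \<ge> R"
    and eval_fps_prod: "norm q < R \<Longrightarrow> eval_fps (\<Prod>k\<in>S. f k) q = (\<Prod>k\<in>S. eval_fps (f k) q)"
proof -
  have "fps_conv_radius (\<Prod>k\<in>S. f k) \<ge> R \<and>
    (norm q < R \<longrightarrow> eval_fps (\<Prod>k\<in>S. f k) q = (\<Prod>k\<in>S. eval_fps (f k) q))"
    using assms
  proof (induction S rule: infinite_finite_induct)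
    case (insert k S)
    then have k: "fps_conv_radius (f k) \<ge> R" and S: "fps_conv_radius (\<Prod>k\<in>S. f k) \<ge> R"
      by auto
    have "R \<le> fps_conv_radius (f k * (\<Prod>k\<in>S. f k))"
      using k S by (intro order_trans[OF _ fps_conv_radius_mult]) simp
    moreover have "eval_fps (f k * (\<Prod>k\<in>S. f k)) q = eval_fps (f k) q * eval_fps (\<Prod>k\<in>S. f k) q"
      if "norm q < R"
      using that k S by (intro eval_fps_mult) (auto intro: less_le_trans)
    ultimately show ?case using insert by auto
  qed auto
  then show "fps_conv_radius (\<Prod>k\<in>S. f k) \<ge> R"
    "norm q < R \<Longrightarrow> eval_fps (\<Prod>k\<in>S. f k) q = (\<Prod>k\<in>S. eval_fps (f k) q)"
    by auto
qed

section \<open>Binomial sums and the absolutely convergent majorant\<close>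

lemma binomial_weight_eq_gbinomial:
  "binomial_weight b z r * x ^ r = (- b gchoose r) * (- (z * x)) ^ r"
  by (simp add: binomial_weight_def gbinomial_pochhammer power_mult_distrib[symmetric] mult_ac)

lemma binomial_weight_sums_complex:
  assumes "norm (z * x) < 1"
  shows "(\<lambda>r. binomial_weight b z r * x ^ r) sums ((1 - z * x) powr (- b :: complex))"
  unfolding binomial_weight_eq_gbinomial
  using gen_binomial_complex[of "- (z * x)" "- b"] assms by simp

lemma binomial_weight_sums_real:
  assumes "\<bar>z * x\<bar> < 1"
  shows "(\<lambda>r. binomial_weight b z r * x ^ r) sums ((1 - z * x) powr (- b :: real))"
  unfolding binomial_weight_eq_gbinomial
  using gen_binomial_real[of "- (z * x)" "- b"] assms by simp

text \<open>Factor by factor, |b + i| \<le> |b| + i.\<close>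

lemma norm_pochhammer_le:
  fixes b :: "'a::{real_normed_field}"
  shows "norm (pochhammer b r) \<le> pochhammer (norm b) r"
  unfolding pochhammer_prod prod_norm[symmetric]
  by (intro prod_mono) (auto intro: norm_triangle_le)

lemma norm_binomial_weight_le:
  fixes b z :: "'a::{real_normed_field}"
  shows "norm (binomial_weight b z r) \<le> binomial_weight (norm b) (norm z) r"
  unfolding binomial_weight_def
  by (simp add: norm_mult norm_divide norm_power mult_right_mono divide_right_mono norm_pochhammer_le)

text \<open>From ln y \<le> y - 1 at y = 1 / (1 - x). The uniform \<open>\<rho>\<close> makes the
  exponent linear in x, so that the bounds for all factors add up.\<close>

lemma one_minus_powr_le_exp:
  fixes x \<beta> :: real
  assumes "0 \<le> x" "x \<le> \<rho>" "\<rho> < 1" "\<beta> \<ge> 0"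
  shows "(1 - x) powr (- \<beta>) \<le> exp (\<beta> * x / (1 - \<rho>))"
proof -
  have "- ln (1 - x) = ln (1 / (1 - x))"
    using assms by (simp add: ln_div)
  also have "\<dots> \<le> 1 / (1 - x) - 1"
    using assms by (intro ln_le_minus_one) auto
  also have "\<dots> = x / (1 - x)"
    using assms by (simp add: field_simps)
  also have "\<dots> \<le> x / (1 - \<rho>)"
    using assms by (intro divide_left_mono) auto
  finally have "\<beta> * (- ln (1 - x)) \<le> \<beta> * (x / (1 - \<rho>))"
    using assms by (intro mult_left_mono)
  then show ?thesis
    using assms by (simp add: powr_def)
qed

text \<open>Comparison with the real binomial series for |b| and |z|, followed by
  \<open>one_minus_powr_le_exp\<close> with \<open>\<rho>\<close> = |z|.\<close>

lemma norm_binomial_weight_sums: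
  fixes b z :: complex and x :: real
  assumes "norm z < 1" "0 \<le> x" "x \<le> 1"
  obtains s where "(\<lambda>r. norm (binomial_weight b z r) * x ^ r) sums s" 
    "0 \<le> s" "s \<le> exp (norm b * (norm z * x) / (1 - norm z))"
proof -
  let ?h = "\<lambda>r. norm (binomial_weight b z r) * x ^ r"
  have zx: "norm z * x \<le> norm z" using assms by (simp add: mult_left_le)
  have h: "?h r \<le> binomial_weight (norm b) (norm z) r * x ^ r" for r
    using assms by (intro mult_right_mono norm_binomial_weight_le) auto
  have sums: "(\<lambda>r. binomial_weight (norm b) (norm z) r * x ^ r) sums ((1 - norm z * x) powr (- norm b))"
    using assms zx by (intro binomial_weight_sums_real) (simp add: abs_mult)
  have "summable ?h"
    using assms h by (intro summable_comparison_test'[OF sums_summable[OF sums], of 0]) (auto simp: abs_mult)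
  then have s: "?h sums suminf ?h" by (rule summable_sums)
  have "suminf ?h \<le> (1 - norm z * x) powr (- norm b)"
    using sums_le[OF h s sums] .
  also have "\<dots> \<le> exp (norm b * (norm z * x) / (1 - norm z))"
    using assms zx by (intro one_minus_powr_le_exp) auto
  finally show ?thesis
    using that[OF s] assms \<open>summable ?h\<close> by (simp add: suminf_nonneg)
qed

lemma sum_norm_partition_weight:
  assumes "n \<le> N"
  shows "(\<Sum>\<pi>\<in>partitions_in {0<..} n. norm (partition_weight b z \<pi>)) =
    (\<Prod>k\<in>{0<..N}. Abs_fps (\<lambda>r. norm (binomial_weight (b k) z r)) oo fps_X ^ k) $ n"
proof -
  have "(\<Prod>k\<in>{0<..N}. Abs_fps (\<lambda>r. norm (binomial_weight (b k) z r)) oo fps_X ^ k) $ n =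
      (\<Sum>\<pi>\<in>partitions_in {0<..N} n. \<Prod>k\<in>{0<..N}. norm (binomial_weight (b k) z (count \<pi> k)))"
    by (rule prod_compose_power_nth) auto
  also have "\<dots> = (\<Sum>\<pi>\<in>partitions_in {0<..N} n. norm (partition_weight b z \<pi>))"
    by (intro sum.cong refl)
       (auto simp: partitions_in_def partition_weight_eq[where S = "{0<..N}"] prod_norm)
  finally show ?thesis
    using assms by (simp add: partitions_in_positive)
qed

lemma summable_norm_partition_weight:
  assumes z: "norm z < 1" and q: "norm q < 1"
    and summable: "summable (\<lambda>k. norm (b (Suc k) * (z * q ^ Suc k)))"
  shows "summable (\<lambda>n. (\<Sum>\<pi>\<in>partitions_in {0<..} n. norm (partition_weight b z \<pi>)) * norm q ^ n)"
proof (rule summableI_nonneg_bounded)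
  let ?p = "\<lambda>n. \<Sum>\<pi>\<in>partitions_in {0<..} n. norm (partition_weight b z \<pi>)"
  let ?G = "\<lambda>k. Abs_fps (\<lambda>r. norm (binomial_weight (b k) z r)) oo fps_X ^ k"
  let ?e = "\<lambda>k. norm (b k * (z * q ^ k))"
  show "0 \<le> ?p n * norm q ^ n" for n
    by (intro mult_nonneg_nonneg sum_nonneg) auto
  fix N
  have radius: "fps_conv_radius (?G k) \<ge> 1" if "k > 0" for k
  proof (rule fps_conv_radius_compose_power[OF that])
    fix x :: real assume "norm x < 1"
    then have "summable (\<lambda>r. norm (binomial_weight (b k) z r) * \<bar>x\<bar> ^ r)"
      using norm_binomial_weight_sums[OF z, of "\<bar>x\<bar>" "b k"] by (auto simp: summable_def)
    then show "summable (\<lambda>r. norm (binomial_weight (b k) z r) * x ^ r)"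
      by (intro summable_norm_cancel[where f = "\<lambda>r. _ r * _ r"]) (simp add: abs_mult power_abs)
  qed
  have eval: "0 \<le> eval_fps (?G k) (norm q) \<and>
      eval_fps (?G k) (norm q) \<le> exp (?e k / (1 - norm z))" if "k > 0" for k
  proof -
    have "norm q ^ k \<le> 1" using q by (simp add: power_le_one)
    then obtain s where "(\<lambda>r. norm (binomial_weight (b k) z r) * (norm q ^ k) ^ r) sums s"
      "0 \<le> s" "s \<le> exp (norm (b k) * (norm z * norm q ^ k) / (1 - norm z))"
      using norm_binomial_weight_sums[OF z, of "norm q ^ k" "b k"] by auto
    then show ?thesis
      using eval_fps_compose_power[OF that, of _ "norm q"] by (simp add: norm_mult norm_power)
  qed
  \<comment> \<open>Indices below N involve only parts up to N, so the finite product has exactly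
    these coefficients. All its coefficients are nonnegative, so the partial sum is at most its
    value at |q|.\<close>
  have "(\<Sum>n<N. ?p n * norm q ^ n) = (\<Sum>n<N. (\<Prod>k\<in>{0<..N}. ?G k) $ n * norm q ^ n)"
    by (intro sum.cong) (auto simp: sum_norm_partition_weight[where N = N])
  also have "\<dots> \<le> eval_fps (\<Prod>k\<in>{0<..N}. ?G k) (norm q)"
    unfolding eval_fps_def
  proof (rule sum_le_suminf)
    have "fps_conv_radius (\<Prod>k\<in>{0<..N}. ?G k) \<ge> 1"
      using radius by (intro fps_conv_radius_prod) auto
    then have "ereal (norm (norm q)) < fps_conv_radius (\<Prod>k\<in>{0<..N}. ?G k)"
      using q by (auto intro: less_le_trans[of "ereal (norm q)" 1])
    then show "summable (\<lambda>n. (\<Prod>k\<in>{0<..N}. ?G k) $ n * norm q ^ n)"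
      by (rule summable_fps)
    show "0 \<le> (\<Prod>k\<in>{0<..N}. ?G k) $ n * norm q ^ n" for n
      by (subst prod_compose_power_nth) (auto intro!: mult_nonneg_nonneg sum_nonneg prod_nonneg)
  qed auto
  also have "\<dots> = (\<Prod>k\<in>{0<..N}. eval_fps (?G k) (norm q))"
    using radius q by (intro eval_fps_prod) auto
  also have "\<dots> \<le> (\<Prod>k\<in>{0<..N}. exp (?e k / (1 - norm z)))"
    using eval by (intro prod_mono) auto
  also have "\<dots> = exp ((\<Sum>k\<in>{0<..N}. ?e k) / (1 - norm z))"
    by (simp add: exp_sum sum_divide_distrib)
  also have "(\<Sum>k\<in>{0<..N}. ?e k) = (\<Sum>k<N. ?e (Suc k))"
    by (rule sum.reindex_bij_witness[where i = Suc and j = "\<lambda>k. k - 1"]) auto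
  also have "exp (\<dots> / (1 - norm z)) \<le> exp ((\<Sum>k. ?e (Suc k)) / (1 - norm z))"
    using z by (simp only: exp_le_cancel_iff, intro divide_right_mono sum_le_suminf summable) auto
  finally show "(\<Sum>n<N. ?p n * norm q ^ n) \<le> exp ((\<Sum>k. ?e (Suc k)) / (1 - norm z))" .
qed

section \<open>The product of complex numbers and its power series\<close>

lemma norm_mult_power_less_one:
  fixes z q :: complex
  assumes "norm z < 1" "norm q < 1"
  shows "norm (z * q ^ k) < 1"
proof -
  have "norm z * norm q ^ k \<le> norm z"
    using assms by (intro mult_left_le) (auto simp: power_le_one)
  then show ?thesis using assms by (simp add: norm_mult norm_power)
qed

lemma complex_factor_eq_exp:
  assumes "norm (z * q ^ k) < 1"
  shows "complex_factor b z k q = exp (- (b * Ln (1 - z * q ^ k)))"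
proof -
  \<comment> \<open>At base 0 the value of \<open>powr\<close> is 0 and not an exponential, so this
    case must be excluded.\<close>
  have "1 - z * q ^ k \<noteq> 0" using assms by force
  then show ?thesis
    by (simp add: complex_factor_def powr_def exp_minus field_simps)
qed

text \<open>Logarithms turn the product into a series dominated by the assumed one; the limit is an
  exponential and hence nonzero.\<close>

lemma complex_factor_has_prod:
  assumes z: "norm z < 1" and q: "norm q < 1"
    and summable: "summable (\<lambda>k. norm (b (Suc k) * (z * q ^ Suc k)))"
  shows "\<exists>p. p \<noteq> 0 \<and> (\<lambda>N. \<Prod>k\<le>N. complex_factor (b (Suc k)) z (Suc k) q) \<longlonglongrightarrow> p"
proof -
  let ?x = "\<lambda>k. z * q ^ Suc k"
  let ?l = "\<lambda>k. - (b (Suc k) * Ln (1 - ?x k))"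
  \<comment> \<open>The estimate |Ln (1 - x)| \<le> 2 |x| is available for |x| < 1/2, which holds
    from some index on.\<close>
  have "(\<lambda>k. z * (q ^ Suc k)) \<longlonglongrightarrow> z * 0"
    using q by (intro tendsto_intros LIMSEQ_Suc[where f = "\<lambda>k. q ^ k"] LIMSEQ_power_zero)
  then have "(\<lambda>k. norm (?x k)) \<longlonglongrightarrow> 0"
    by (simp add: tendsto_norm_zero_iff)
  then have "\<forall>\<^sub>F k in sequentially. norm (?x k) < 1 / 2"
    by (rule order_tendstoD) simp
  then have "\<forall>\<^sub>F k in sequentially. norm (?l k) \<le> 2 * norm (b (Suc k) * ?x k)"
  proof eventually_elim
    case (elim k)
    then have "norm (Ln (1 - ?x k)) \<le> 2 * norm (?x k)"
      using norm_Ln_le[of "- ?x k"] by simp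
    then have "norm (b (Suc k)) * norm (Ln (1 - ?x k)) \<le> norm (b (Suc k)) * (2 * norm (?x k))"
      by (intro mult_left_mono) auto
    then show ?case by (simp only: norm_mult norm_minus_cancel mult_ac)
  qed
  then have "summable ?l"
    by (rule summable_comparison_test_ev) (intro summable_mult summable)
  then have "(\<lambda>N. exp (\<Sum>k\<le>N. ?l k)) \<longlonglongrightarrow> exp (suminf ?l)"
    by (intro tendsto_intros summable_LIMSEQ')
  also have "(\<lambda>N. exp (\<Sum>k\<le>N. ?l k)) = (\<lambda>N. \<Prod>k\<le>N. complex_factor (b (Suc k)) z (Suc k) q)"
    by (simp only: exp_sum finite_atMost complex_factor_eq_exp[OF norm_mult_power_less_one[OF z q]])
  finally show ?thesis by (intro exI[of _ "exp (suminf ?l)"]) simp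
qed

text \<open>Tannery's theorem interchanges the sum over n with the limit in N: each term is
  eventually constant in N, and the terms are dominated by \<open>?M\<close> uniformly in N.\<close>

lemma partition_series_sums:
  assumes z: "norm z < 1" and q: "norm q < 1"
    and summable: "summable (\<lambda>k. norm (b (Suc k) * (z * q ^ Suc k)))"
  shows "convergent_prod (\<lambda>k. complex_factor (b (Suc k)) z (Suc k) q)"
    and "summable (\<lambda>n. norm (partition_series b z $ n * q ^ n))"
    and "(\<Sum>n. partition_series b z $ n * q ^ n) = (\<Prod>k. complex_factor (b (Suc k)) z (Suc k) q)"
proof -
  let ?f = "\<lambda>k. fps_factor (b k) z k"
  \<comment> \<open>The bound is \<open>Suc N\<close> because the partial products over k \<le> N of
    shifted factors have N + 1 factors.\<close>
  let ?a = "\<lambda>n N. (\<Prod>k\<in>{0<..Suc N}. ?f k) $ n * q ^ n"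
  let ?M = "\<lambda>n. (\<Sum>\<pi>\<in>partitions_in {0<..} n. norm (partition_weight b z \<pi>)) * norm q ^ n"
  obtain p where p: "p \<noteq> 0" "(\<lambda>N. \<Prod>k\<le>N. complex_factor (b (Suc k)) z (Suc k) q) \<longlonglongrightarrow> p"
    using complex_factor_has_prod[where b = b, OF assms] by blast
  then have has_prod: "(\<lambda>k. complex_factor (b (Suc k)) z (Suc k) q) has_prod p"
    by (simp add: has_prod_def raw_has_prod_def)
  then show "convergent_prod (\<lambda>k. complex_factor (b (Suc k)) z (Suc k) q)"
    by (auto simp: has_prod_def convergent_prod_def)
  have radius: "fps_conv_radius (?f k) \<ge> 1" if "k > 0" for k
    unfolding fps_factor_eq[OF that]
  proof (rule fps_conv_radius_compose_power[OF that])
    fix x :: complex assume "norm x < 1"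
    then have "norm (z * x) < 1" using norm_mult_power_less_one[OF z, of x 1] by simp
    then show "summable (\<lambda>r. binomial_weight (b k) z r * x ^ r)"
      using binomial_weight_sums_complex sums_summable by blast
  qed
  have eval: "eval_fps (?f k) q = complex_factor (b k) z k q" if "k > 0" for k
    unfolding fps_factor_eq[OF that]
    using eval_fps_compose_power[OF that binomial_weight_sums_complex[OF norm_mult_power_less_one[OF z q]]]
    by (simp add: complex_factor_def powr_minus_divide)
  have tannery: "(\<forall>\<^sub>F N in sequentially. summable (\<lambda>n. norm (?a n N))) \<and>
      summable (\<lambda>n. norm (partition_series b z $ n * q ^ n)) \<and>
      (\<lambda>N. \<Sum>n. ?a n N) \<longlonglongrightarrow> (\<Sum>n. partition_series b z $ n * q ^ n)"
  proof (rule tannerys_theorem)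
    fix n
    have "\<forall>\<^sub>F N in sequentially. ?a n N = partition_series b z $ n * q ^ n"
      using eventually_ge_at_top[of n] by eventually_elim (simp add: prod_fps_factor_nth)
    then show "(\<lambda>N. ?a n N) \<longlonglongrightarrow> partition_series b z $ n * q ^ n"
      by (rule tendsto_eventually)
  next
    have "norm (?a n N) \<le> ?M n" for n N
    proof -
      have "(\<Prod>k\<in>{0<..Suc N}. ?f k) $ n =
          (\<Sum>\<pi>\<in>partitions_in {0<..Suc N} n. partition_weight b z \<pi>)"
        by (rule prod_fps_factor_nth_partitions)
      then have "norm ((\<Prod>k\<in>{0<..Suc N}. ?f k) $ n) \<le>
          (\<Sum>\<pi>\<in>partitions_in {0<..Suc N} n. norm (partition_weight b z \<pi>))"
        by (simp add: norm_sum)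
      also have "\<dots> \<le> (\<Sum>\<pi>\<in>partitions_in {0<..} n. norm (partition_weight b z \<pi>))"
        \<comment> \<open>Restricting the parts only removes nonnegative terms, which makes the
          bound independent of N.\<close>
        by (intro sum_mono2) (auto simp: finite_partitions_in, auto simp: partitions_in_def)
      finally show ?thesis
        by (simp add: norm_mult norm_power mult_right_mono)
    qed
    then show "\<forall>\<^sub>F (n, N) in at_top \<times>\<^sub>F sequentially. norm (?a n N) \<le> ?M n"
      by (intro always_eventually) auto
    show "summable ?M"
      by (rule summable_norm_partition_weight[OF assms])
  qed simp
  then show "summable (\<lambda>n. norm (partition_series b z $ n * q ^ n))" by blast
  have "(\<Sum>n. ?a n N) = (\<Prod>k\<le>N. complex_factor (b (Suc k)) z (Suc k) q)" for N
  proof -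
    have "(\<Sum>n. ?a n N) = eval_fps (\<Prod>k\<in>{0<..Suc N}. ?f k) q"
      by (simp add: eval_fps_def)
    also have "\<dots> = (\<Prod>k\<in>{0<..Suc N}. eval_fps (?f k) q)"
      using radius q by (intro eval_fps_prod) auto
    also have "\<dots> = (\<Prod>k\<in>{0<..Suc N}. complex_factor (b k) z k q)"
      using eval by (intro prod.cong) auto
    finally show ?thesis
      by (simp only: prod_atMost_Suc_shift[where f = "\<lambda>k. complex_factor (b k) z k q"])
  qed
  then have "(\<lambda>N. \<Prod>k\<le>N. complex_factor (b (Suc k)) z (Suc k) q)
      \<longlonglongrightarrow> (\<Sum>n. partition_series b z $ n * q ^ n)"
    using tannery by simp
  then have "(\<Sum>n. partition_series b z $ n * q ^ n) = p"
    using LIMSEQ_unique p(2) by blast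
  then show "(\<Sum>n. partition_series b z $ n * q ^ n) = (\<Prod>k. complex_factor (b (Suc k)) z (Suc k) q)"
    using has_prod_unique[OF has_prod] by simp
qed

theorem theorem2p5:
  fixes b c :: "nat \<Rightarrow> complex" and z t :: complex and P :: "nat \<Rightarrow> complex"
  assumes z: "norm z < 1" and t: "norm t < 1"
    and P: "(\<Prod>k. fps_factor (b (Suc k)) z (Suc k)) * (\<Prod>k. fps_factor (c (Suc k)) t (Suc k))
              = Abs_fps P"
  shows
    "convergent_prod (\<lambda>k. fps_factor (b (Suc k)) z (Suc k))
     \<and> convergent_prod (\<lambda>k. fps_factor (c (Suc k)) t (Suc k))
     \<and> (\<forall>q. norm q < 1
          \<and> summable (\<lambda>k. norm (b (Suc k) * (z * q ^ Suc k)))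
          \<and> summable (\<lambda>k. norm (c (Suc k) * (t * q ^ Suc k))) \<longrightarrow>
          convergent_prod (\<lambda>k. complex_factor (b (Suc k)) z (Suc k) q)
          \<and> convergent_prod (\<lambda>k. complex_factor (c (Suc k)) t (Suc k) q)
          \<and> (\<lambda>n. P n * q ^ n) sums
              ((\<Prod>k. complex_factor (b (Suc k)) z (Suc k) q)
               * (\<Prod>k. complex_factor (c (Suc k)) t (Suc k) q)))
     \<and> (\<forall>n. P n = (\<Sum>(\<pi>, \<mu>) \<in> partition_pairs n. partition_weight b z \<pi> * partition_weight c t \<mu>))
     \<and> (\<forall>n\<ge>1. \<forall>i\<in>{1..n}.
          F_z b c z t i n + F_t b c z t i n = (\<Sum>j=1..n. row_coeff b c z t i j * P (n - j)))
     \<and> (\<forall>n\<ge>1. \<forall>s\<in>{1..n}.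
          F_z b c z t s n = (\<Sum>j=1..n. split_row_coeff b c z t (2 * s - 1) j * P (n - j))
          \<and> F_t b c z t s n = (\<Sum>j=1..n. split_row_coeff b c z t (2 * s) j * P (n - j)))"
proof -
  \<comment> \<open>The values of the formal products are unique, so the hypothesis on
    \<open>P\<close> becomes a statement about \<open>partition_series\<close>.\<close>
  have P_fps: "partition_series b z * partition_series c t = Abs_fps P"
    using P fps_factor_has_prod[THEN has_prod_unique] by metis
  then have P_nth: "(partition_series b z * partition_series c t) $ n = P n" for n
    by simp
  have Fz: "F_z b c z t k n = (\<Sum>j=1..n. (if \<exists>r\<ge>1. j = r * k then b k * z ^ (j div k) else 0) * P (n - j))"
    if "k > 0" for k n
    by (simp only: F_z_eq_sum[OF that] P_nth)
  have Ft: "F_t b c z t k n = (\<Sum>j=1..n. (if \<exists>r\<ge>1. j = r * k then c k * t ^ (j div k) else 0) * P (n - j))"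
    if "k > 0" for k n
    \<comment> \<open>Exchanging the roles of the two partitions reduces this to the case of
      \<open>F_z\<close>; the product of the two series is symmetric.\<close>
    by (simp only: F_t_eq_F_z F_z_eq_sum[OF that] P_nth mult.commute[of "partition_series c t"])
  show ?thesis
  proof (intro conjI allI impI ballI)
    show "convergent_prod (\<lambda>k. fps_factor (b (Suc k)) z (Suc k))"
      "convergent_prod (\<lambda>k. fps_factor (c (Suc k)) t (Suc k))"
      using fps_factor_has_prod unfolding has_prod_def convergent_prod_def by blast+
  next
    fix q assume q: "norm q < 1 \<and> summable (\<lambda>k. norm (b (Suc k) * (z * q ^ Suc k)))
          \<and> summable (\<lambda>k. norm (c (Suc k) * (t * q ^ Suc k)))"
    note b = partition_series_sums[OF z, of q b]
    note c = partition_series_sums[OF t, of q c]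
    show "convergent_prod (\<lambda>k. complex_factor (b (Suc k)) z (Suc k) q)"
      "convergent_prod (\<lambda>k. complex_factor (c (Suc k)) t (Suc k) q)"
      using b(1) c(1) q by blast+
    \<comment> \<open>Absolute convergence of both series permits the Cauchy product.\<close>
    have "(\<lambda>n. \<Sum>i\<le>n. (partition_series b z $ i * q ^ i) * (partition_series c t $ (n - i) * q ^ (n - i)))
      sums ((\<Prod>k. complex_factor (b (Suc k)) z (Suc k) q) * (\<Prod>k. complex_factor (c (Suc k)) t (Suc k) q))"
      using Cauchy_product_sums[OF b(2) c(2)] b(3) c(3) q by auto
    also have "(\<lambda>n. \<Sum>i\<le>n. (partition_series b z $ i * q ^ i) * (partition_series c t $ (n - i) * q ^ (n - i)))
      = (\<lambda>n. P n * q ^ n)"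
    proof
      fix n
      have "(\<Sum>i\<le>n. (partition_series b z $ i * q ^ i) * (partition_series c t $ (n - i) * q ^ (n - i)))
        = (\<Sum>i\<le>n. partition_series b z $ i * partition_series c t $ (n - i) * q ^ n)"
        by (intro sum.cong) (auto simp: mult_ac simp flip: power_add)
      then show "(\<Sum>i\<le>n. (partition_series b z $ i * q ^ i) * (partition_series c t $ (n - i) * q ^ (n - i)))
        = P n * q ^ n"
        by (simp add: P_nth[symmetric] fps_mult_nth sum_distrib_right atMost_atLeast0)
    qed
    finally show "(\<lambda>n. P n * q ^ n) sums
        ((\<Prod>k. complex_factor (b (Suc k)) z (Suc k) q) * (\<Prod>k. complex_factor (c (Suc k)) t (Suc k) q))" .
  next
    fix n
    show "P n = (\<Sum>(\<pi>, \<mu>) \<in> partition_pairs n. partition_weight b z \<pi> * partition_weight c t \<mu>)"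
      by (simp only: sum_partition_weight_pairs P_nth)
  next
    fix n i :: nat assume "i \<in> {1..n}"
    then have "i > 0" by simp
    then show "F_z b c z t i n + F_t b c z t i n = (\<Sum>j=1..n. row_coeff b c z t i j * P (n - j))"
      unfolding Fz[OF \<open>i > 0\<close>] Ft[OF \<open>i > 0\<close>] sum.distrib[symmetric] row_coeff_def
      by (intro sum.cong) (auto simp: algebra_simps)
  next
    fix n s :: nat assume "s \<in> {1..n}"
    \<comment> \<open>Positivity of s matters for the truncated subtraction: it makes 2 s - 1 odd
      and lets both rows decode to the same s.\<close>
    then have s: "s > 0" "odd (2 * s - 1)" "(2 * s - 1 + 1) div 2 = s"
      "\<not> odd (2 * s)" "(2 * s + 1) div 2 = s" by auto
    show "F_z b c z t s n = (\<Sum>j=1..n. split_row_coeff b c z t (2 * s - 1) j * P (n - j))"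
      unfolding Fz[OF s(1)] split_row_coeff_def Let_def s(3) if_P[OF s(2)] ..
    show "F_t b c z t s n = (\<Sum>j=1..n. split_row_coeff b c z t (2 * s) j * P (n - j))"
      unfolding Ft[OF s(1)] split_row_coeff_def Let_def s(5) if_not_P[OF s(4)] ..
  qed
qed

end
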